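(* Let $X, X_1, X_2, \ldots$ be i.i.d. real random variables, let $F,U:\mathbb{R}\to\mathbb{R}$, and write $S_n=\sum_{i=1}^nF(X_i)$, $T_n=\sum_{i=1}^nU(X_i)$. Suppose $E[F(X)]=E[U(X)]=0$, $\mathrm{Var}(F(X))\le1$, $\mathrm{Var}(U(X))=1$, and that $m(\beta):=\operatorname{ess\,sup}[F(X)-\beta U(X)]<\infty$ for all $\beta>0$. Then the following hold for all $n\ge1$: (i) For any $\varepsilon,u>0$, if there exists $\beta>0$ such that $m(\beta)\le\varepsilon-\beta u$, then $$\Pr\{S_n>n\varepsilon,\ |T_n|<nu\}=0.$$ (ii) For any $\varepsilon,u>0$, $$\log\Pr\{S_n>n\varepsilon,\ |T_n|<nu\}\le-2n\sup_{\alpha\in(0,1)}\left[\frac{m\cdot(1-\alpha)}{m^2+1+(\alpha\varepsilon/u)^2-2\alpha\gamma\varepsilon/u}\right]^2\varepsilon^2,$$ where $m:=m\left(\frac{\alpha\varepsilon}{u}\right)$ and $\gamma:=E[F(X)U(X)]$ is the covariance between $F(X)$ and $U(X)$. (iii) Let $K>0$ be arbitrary. Then for any $\varepsilon>0$ and any $0<u\le K\varepsilon$, $$\log\Pr\{S_n>n\varepsilon,\ |T_n|<nu\}\le-\frac n2\left[\frac{M}{M^2+\left(1+\frac1{2K}\right)^2}\right]^2\varepsilon^2,$$ where $M=m\left(\frac1{2K}\right)$.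
   Context: Functions are Borel measurable. The essential supremum is with respect to the law of $X$. Convention: $\log0=-\infty$. *)

theory Defs
  imports "HOL-Probability.Probability"
begin

definition iid_vars :: "'a measure \<Rightarrow> ('i \<Rightarrow> 'a \<Rightarrow> real) \<Rightarrow> 'i set \<Rightarrow> bool" where
  "iid_vars M X I \<longleftrightarrow>
     prob_space.indep_vars M (\<lambda>_. borel) X I \<and>
     (\<forall>i\<in>I. \<forall>j\<in>I. distr M borel (X i) = distr M borel (X j))"

(* S_n is psum F Xs n and T_n is psum U Xs n, for a sequence Xs whose indices start at 1. *)
definition psum :: "(real \<Rightarrow> real) \<Rightarrow> (nat \<Rightarrow> 'a \<Rightarrow> real) \<Rightarrow> nat \<Rightarrow> 'a \<Rightarrow> real" where
  "psum F Xs n \<omega> = (\<Sum>i=1..n. F (Xs i \<omega>))"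

(* m(\<beta>): the essential supremum with respect to the law of X, an extended real. *)
definition ess_m ::
  "'a measure \<Rightarrow> ('a \<Rightarrow> real) \<Rightarrow> (real \<Rightarrow> real) \<Rightarrow> (real \<Rightarrow> real) \<Rightarrow> real \<Rightarrow> ereal" where
  "ess_m M X F U \<beta> = esssup (distr M borel X) (\<lambda>x. ereal (F x - \<beta> * U x))"

(* Natural logarithm of a nonnegative real, with log 0 = -\<infinity>
   (the library function has ln 0 = 0). *)
definition log_ext :: "real \<Rightarrow> ereal" where
  "log_ext p = (if p = 0 then -\<infinity> else ereal (ln p))"

end

theory Submission
  imports Defs
begin

text \<open>
  For \<open>\<beta> > 0\<close> put \<open>Y\<^sub>i = F(X\<^sub>i) - \<beta> U(X\<^sub>i)\<close>. On the event in question \<open>\<Sum>Y\<^sub>i > n(\<epsilon> - \<beta>u)\<close>,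
  while \<open>Y\<^sub>i\<close> is centred, bounded above by \<open>m(\<beta>)\<close>, and has variance at most \<open>v = 1 + \<beta>\<^sup>2 - 2\<beta>\<gamma>\<close>.
  Hence (i). Among such variables the exponential moments are maximised by the two-point law on
  \<open>{-v/m, m}\<close>, whose range is \<open>(m\<^sup>2 + v)/m\<close>; Hoeffding's lemma and a Chernoff bound then give
  \<open>Pr{\<Sum>Y\<^sub>i \<ge> nt} \<le> exp(-2n (mt/(m\<^sup>2 + v))\<^sup>2)\<close>. Taking \<open>\<beta> = \<alpha>\<epsilon>/u\<close> gives (ii); taking \<open>\<beta> = 1/(2K)\<close>, where
  \<open>\<epsilon> - \<beta>u \<ge> \<epsilon>/2\<close> and \<open>v \<le> (1 + \<beta>)\<^sup>2\<close> because \<open>\<gamma> \<ge> -1\<close>, gives (iii).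
\<close>

section \<open>Exponential moments of centred variables bounded above\<close>

text \<open>The parabola is tangent to exp at 0 and meets it again at \<open>a\<close>. For
  \<open>x > 0\<close> the bound says that \<open>(exp y - 1 - y) / y\<^sup>2\<close> is
  nondecreasing on positive reals. For \<open>x \<le> 0\<close> the coefficient 1/2 suffices, and
  the coefficient used here is at least that.\<close>

lemma exp_le_quadratic:
  fixes a x :: real
  assumes "0 < a" "x \<le> a"
  shows "exp x \<le> 1 + x + (exp a - 1 - a) / a\<^sup>2 * x\<^sup>2"
proof (cases "x \<le> 0")
  case True
  define h where "h = (\<lambda>y::real. 1 + y + y\<^sup>2 / 2 - exp y)"
  have "h 0 \<le> h x"
  proof (rule DERIV_nonpos_imp_nonincreasing[OF True])
    fix y :: real
    have "(h has_real_derivative 1 + y - exp y) (at y)"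
      unfolding h_def by (auto intro!: derivative_eq_intros)
    moreover have "1 + y - exp y \<le> 0"
      using exp_ge_add_one_self[of y] by linarith
    ultimately show "\<exists>d. (h has_real_derivative d) (at y) \<and> d \<le> 0"
      by blast
  qed
  then have "exp x \<le> 1 + x + 1 / 2 * x\<^sup>2"
    by (simp add: h_def)
  also have "1 / 2 \<le> (exp a - 1 - a) / a\<^sup>2"
    using exp_lower_Taylor_quadratic[of a] \<open>0 < a\<close> by (simp add: field_simps)
  then have "1 + x + 1 / 2 * x\<^sup>2 \<le> 1 + x + (exp a - 1 - a) / a\<^sup>2 * x\<^sup>2"
    by (intro add_left_mono mult_right_mono) auto
  finally show ?thesis .
next
  case False
  \<comment> \<open>The numerator of the derivative of the quotient \<open>g\<close> below, which is
    \<open>k y / y ^ 3\<close>. Its own derivative is nonnegative because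
    \<open>1 - z \<le> exp (- z)\<close>, and \<open>k 0 = 0\<close>.\<close>
  define k where "k = (\<lambda>y::real. y * exp y - 2 * exp y + 2 + y)"
  have k_nonneg: "0 \<le> k y" if "0 \<le> y" for y
  proof -
    have "k 0 \<le> k y"
    proof (rule DERIV_nonneg_imp_nondecreasing[OF that])
      fix z :: real
      have "(k has_real_derivative 1 - exp z * (1 - z)) (at z)"
        unfolding k_def by (auto intro!: derivative_eq_intros simp: algebra_simps)
      moreover have "exp z * (1 - z) \<le> exp z * exp (- z)"
        using exp_ge_add_one_self[of "- z"] by (intro mult_left_mono) auto
      ultimately show "\<exists>d. (k has_real_derivative d) (at z) \<and> 0 \<le> d"
        by (intro exI[of _ "1 - exp z * (1 - z)"]) (simp flip: exp_add)
    qed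
    then show ?thesis by (simp add: k_def)
  qed
  define g where "g = (\<lambda>y::real. (exp y - 1 - y) / y\<^sup>2)"
  have "g x \<le> g a"
  proof (rule DERIV_nonneg_imp_nondecreasing[OF \<open>x \<le> a\<close>])
    fix y assume "x \<le> y" "y \<le> a"
    with False have "0 < y" by simp
    have "(g has_real_derivative k y / y ^ 3) (at y)"
      unfolding g_def k_def using \<open>0 < y\<close>
      by (auto intro!: derivative_eq_intros simp: field_simps power2_eq_square power3_eq_cube)
    with k_nonneg[of y] \<open>0 < y\<close>
    show "\<exists>d. (g has_real_derivative d) (at y) \<and> 0 \<le> d"
      by (intro exI[of _ "k y / y ^ 3"]) auto
  qed
  then have "g x * x\<^sup>2 \<le> g a * x\<^sup>2"
    by (rule mult_right_mono) simp
  with False show ?thesis by (simp add: g_def)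
qed

text \<open>
  The quadratic majorant touches \<open>y \<mapsto> exp (l * y)\<close> tangentially at \<open>- s\<close> and meets it again at \<open>m\<close>;
  its expectation is the exponential moment of the two-point law with mass \<open>p\<close> at \<open>m\<close>.
\<close>
lemma (in prob_space) one_sided_mgf_bound:
  fixes Y :: "'a \<Rightarrow> real"
  assumes le: "AE x in M. Y x \<le> m" and "0 < m" "0 < l"
    and int: "integrable M Y" "integrable M (\<lambda>x. (Y x)\<^sup>2)"
    and mean: "expectation Y = 0" and var: "expectation (\<lambda>x. (Y x)\<^sup>2) \<le> v"
  shows "(\<integral>\<^sup>+x. ennreal (exp (l * Y x)) \<partial>M) \<le> ennreal (exp (l\<^sup>2 * ((m\<^sup>2 + v) / m)\<^sup>2 / 8))"
proof -
  have "0 \<le> expectation (\<lambda>x. (Y x)\<^sup>2)" by simp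
  with var have "0 \<le> v" by linarith
  \<comment> \<open>\<open>a\<close> is \<open>l\<close> times the distance between the two atoms
    \<open>- s\<close> and \<open>m\<close>. In \<open>q\<close> the square of
    \<open>l * (Y x + s)\<close> is written out, so that its expectation follows by linearity from
    the first two moments of \<open>Y\<close>.\<close>
  define s where "s = v / m"
  define p where "p = v / (m\<^sup>2 + v)"
  define a where "a = l * (m + s)"
  define c where "c = (exp a - 1 - a) / a\<^sup>2"
  define q where "q = (\<lambda>x. exp (- l * s) * (1 + l * (Y x + s) + c * (l\<^sup>2 * ((Y x)\<^sup>2 + 2 * s * Y x + s\<^sup>2))))"
  have "0 \<le> s" "0 \<le> p"
    using \<open>0 \<le> v\<close> \<open>0 < m\<close> by (auto simp: s_def p_def)
  then have "0 < a"
    using \<open>0 < m\<close> \<open>0 < l\<close> by (simp add: a_def)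
  have "0 \<le> c"
    using exp_ge_add_one_self[of a] unfolding c_def
    by (intro divide_nonneg_nonneg) (linarith, simp)
  \<comment> \<open>For the two-point law, the variable shifted by \<open>s\<close> equals
    \<open>m + s\<close> with probability \<open>p\<close> and 0 otherwise. Its first two moments,
    scaled by \<open>l\<close> and \<open>l\<^sup>2\<close>, give these identities: they express
    mean 0 and variance \<open>v\<close>.\<close>
  have "l * s = a * p" and "l\<^sup>2 * (v + s\<^sup>2) = a\<^sup>2 * p"
  proof -
    have "m\<^sup>2 + v > 0" using \<open>0 < m\<close> \<open>0 \<le> v\<close> by (simp add: add_pos_nonneg)
    moreover have "m + s = (m\<^sup>2 + v) / m"
      using \<open>0 < m\<close> by (simp add: s_def field_simps power2_eq_square)
    ultimately have s: "(m + s) * p = s"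
      using \<open>0 < m\<close> by (simp add: p_def s_def)
    then show "l * s = a * p" by (simp add: a_def)
    have "v + s\<^sup>2 = (m + s) * s"
      using \<open>0 < m\<close> by (simp add: s_def field_simps power2_eq_square)
    also have "\<dots> = (m + s)\<^sup>2 * p"
      using s by (simp add: power2_eq_square)
    finally show "l\<^sup>2 * (v + s\<^sup>2) = a\<^sup>2 * p"
      by (simp add: a_def power_mult_distrib)
  qed
  have le_q: "AE x in M. exp (l * Y x) \<le> q x"
    using le
  proof eventually_elim
    case (elim x)
    then have "l * (Y x + s) \<le> a"
      using \<open>0 < l\<close> by (simp add: a_def)
    from exp_le_quadratic[OF \<open>0 < a\<close> this]
    have "exp (- l * s) * exp (l * (Y x + s))
        \<le> exp (- l * s) * (1 + l * (Y x + s) + c * (l * (Y x + s))\<^sup>2)"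
      unfolding c_def by (intro mult_left_mono) auto
    also have "exp (- l * s) * exp (l * (Y x + s)) = exp (l * Y x)"
      by (simp add: algebra_simps flip: exp_add)
    also have "(l * (Y x + s))\<^sup>2 = l\<^sup>2 * ((Y x)\<^sup>2 + 2 * s * Y x + s\<^sup>2)"
      by (simp add: power2_eq_square algebra_simps)
    finally show ?case by (simp only: q_def)
  qed
  have int_q: "integrable M q"
    unfolding q_def using int by simp
  \<comment> \<open>Working with the nonnegative integral means that only \<open>q\<close>, not the
    exponential itself, has to be shown integrable.\<close>
  have "(\<integral>\<^sup>+x. ennreal (exp (l * Y x)) \<partial>M) \<le> (\<integral>\<^sup>+x. ennreal (q x) \<partial>M)"
    using le_q by (intro nn_integral_mono_AE) (auto elim!: eventually_mono intro: ennreal_leI)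
  also have "\<dots> = ennreal (expectation q)"
    using le_q by (intro nn_integral_eq_integral int_q)
      (auto elim!: eventually_mono intro: order_trans[OF exp_ge_zero])
  also have "expectation q
      = exp (- l * s) * (1 + l * s + c * (l\<^sup>2 * (expectation (\<lambda>x. (Y x)\<^sup>2) + s\<^sup>2)))"
    unfolding q_def using int by (simp add: mean prob_space)
  also have "\<dots> \<le> exp (- l * s) * (1 + l * s + c * (l\<^sup>2 * (v + s\<^sup>2)))"
    using var \<open>0 \<le> c\<close> by (intro mult_left_mono add_left_mono add_right_mono) auto
  \<comment> \<open>By the choice of \<open>c\<close>, the quadratic term contributes
    \<open>(exp a - 1 - a) * p\<close>, whose part \<open>- a * p\<close> cancels
    \<open>l * s\<close>. What remains is the moment generating function of a centred Bernoulli law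
    with parameter \<open>p\<close>, scaled by \<open>a\<close>; the bound
    \<open>a\<^sup>2 / 8\<close> on its logarithm is the analytic core of Hoeffding's lemma.\<close>
  also have "\<dots> = exp (- a * p) * (1 + p * (exp a - 1))"
  proof -
    have "c * (a\<^sup>2 * p) = (exp a - 1 - a) * p"
      using \<open>0 < a\<close> by (simp add: c_def)
    then show ?thesis
      unfolding \<open>l\<^sup>2 * (v + s\<^sup>2) = a\<^sup>2 * p\<close> minus_mult_left[symmetric] \<open>l * s = a * p\<close>
      by (simp only:) (simp add: algebra_simps)
  qed
  also have "\<dots> = exp (- a * p + ln (1 + p * (exp a - 1)))"
    unfolding exp_add using \<open>0 < a\<close> \<open>0 \<le> p\<close> by (subst exp_ln) (auto intro: add_pos_nonneg)
  also have "\<dots> \<le> exp (a\<^sup>2 / 8)"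
    using Hoeffdings_lemma_aux[of a p] \<open>0 < a\<close> \<open>0 \<le> p\<close> by simp
  also have "a\<^sup>2 = l\<^sup>2 * ((m\<^sup>2 + v) / m)\<^sup>2"
    using \<open>0 < m\<close> by (simp add: a_def s_def field_simps power2_eq_square)
  finally show ?thesis by (simp add: ennreal_leI)
qed

section \<open>Chernoff bound for independent sums\<close>

lemma (in prob_space) one_sided_tail_bound:
  fixes Y :: "'i \<Rightarrow> 'a \<Rightarrow> real"
  assumes "finite I" "I \<noteq> {}" and indep: "indep_vars (\<lambda>_. borel) Y I"
    and le: "\<And>i. i \<in> I \<Longrightarrow> AE x in M. Y i x \<le> m"
    and int: "\<And>i. i \<in> I \<Longrightarrow> integrable M (Y i)"
      "\<And>i. i \<in> I \<Longrightarrow> integrable M (\<lambda>x. (Y i x)\<^sup>2)"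
    and mean: "\<And>i. i \<in> I \<Longrightarrow> expectation (Y i) = 0"
    and var: "\<And>i. i \<in> I \<Longrightarrow> expectation (\<lambda>x. (Y i x)\<^sup>2) \<le> v"
    and "0 < t"
  shows "prob {x \<in> space M. real (card I) * t \<le> (\<Sum>i\<in>I. Y i x)}
    \<le> exp (- 2 * real (card I) * (m * t / (m\<^sup>2 + v))\<^sup>2)"
proof -
  obtain i where i: "i \<in> I" using \<open>I \<noteq> {}\<close> by blast
  \<comment> \<open>A centred variable cannot have a negative upper bound. If \<open>m = 0\<close>,
    the exponent in the claim is 0 and the claim is the trivial bound by 1.\<close>
  have "expectation (Y i) \<le> expectation (\<lambda>_. m)"
    using le[OF i] int(1)[OF i] by (intro integral_mono_AE) auto
  then have "0 \<le> m" by (simp add: mean[OF i] prob_space)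
  have "0 \<le> expectation (\<lambda>x. (Y i x)\<^sup>2)" by simp
  with var[OF i] have "0 \<le> v" by linarith
  show ?thesis
  proof (cases "m = 0")
    case False
    with \<open>0 \<le> m\<close> have "0 < m" by simp
    \<comment> \<open>\<open>c\<close> is the range of the extremal two-point law, and
      \<open>l\<close> minimises \<open>- l * t + l\<^sup>2 * c\<^sup>2 / 8\<close>; the minimum is
      \<open>- 2 * (t / c)\<^sup>2\<close>.\<close>
    define c where "c = (m\<^sup>2 + v) / m"
    define l where "l = 4 * t / c\<^sup>2"
    have "0 < c" using \<open>0 < m\<close> \<open>0 \<le> v\<close> by (simp add: c_def add_pos_nonneg)
    then have "0 < l" using \<open>0 < t\<close> by (simp add: l_def)
    let ?n = "real (card I)"
    have [measurable]: "random_variable borel (Y j)" if "j \<in> I" for j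
      using int(1)[OF that] by simp
    have "emeasure M {x \<in> space M. ?n * t \<le> (\<Sum>i\<in>I. Y i x)}
        \<le> ennreal (exp (- l * (?n * t))) * (\<integral>\<^sup>+x\<in>space M. exp (l * (\<Sum>i\<in>I. Y i x)) \<partial>M)"
      by (intro Chernoff_ineq_nn_integral_ge \<open>0 < l\<close>) auto
    also have "(\<integral>\<^sup>+x\<in>space M. exp (l * (\<Sum>i\<in>I. Y i x)) \<partial>M)
        = (\<integral>\<^sup>+x. (\<Prod>i\<in>I. ennreal (exp (l * Y i x))) \<partial>M)"
      by (intro nn_integral_cong) (simp add: sum_distrib_left exp_sum \<open>finite I\<close> prod_ennreal)
    also have "\<dots> = (\<Prod>i\<in>I. \<integral>\<^sup>+x. ennreal (exp (l * Y i x)) \<partial>M)"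
      by (intro indep_vars_nn_integral \<open>finite I\<close> indep_vars_compose2[OF indep]) auto
    also have "\<dots> \<le> (\<Prod>i\<in>I. ennreal (exp (l\<^sup>2 * c\<^sup>2 / 8)))"
      unfolding c_def using le int mean var \<open>0 < m\<close> \<open>0 < l\<close>
      by (intro prod_mono_ennreal one_sided_mgf_bound) auto
    also have "\<dots> = ennreal (exp (?n * (l\<^sup>2 * c\<^sup>2 / 8)))"
      by (simp only: prod_constant ennreal_power exp_ge_zero exp_of_nat_mult)
    also have "ennreal (exp (- l * (?n * t))) * \<dots> = ennreal (exp (- l * (?n * t) + ?n * (l\<^sup>2 * c\<^sup>2 / 8)))"
      by (simp only: exp_add ennreal_mult exp_ge_zero)
    also have "- l * (?n * t) + ?n * (l\<^sup>2 * c\<^sup>2 / 8) = - 2 * ?n * (t / c)\<^sup>2"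
    proof -
      have "l\<^sup>2 * c\<^sup>2 / 8 = 2 * (t / c)\<^sup>2" and "l * t = 4 * (t / c)\<^sup>2"
        using \<open>0 < c\<close> by (simp_all add: l_def power2_eq_square)
      then show ?thesis by (simp add: algebra_simps)
    qed
    also have "t / c = m * t / (m\<^sup>2 + v)"
      by (simp add: c_def mult.commute)
    finally show ?thesis
      by (simp add: emeasure_eq_measure mult_left_mono)
  qed simp
qed

section \<open>Essential suprema, products and extended logarithms\<close>

text \<open>The essential supremum refers to the law of \<open>X\<close> alone, so its almost sure
  bound pulls back along any \<open>Z\<close> with that law. This serves every \<open>Xs i\<close>
  with \<open>1 \<le> i\<close>.\<close>

lemma AE_le_of_ess_m_le:
  fixes Z :: "'a \<Rightarrow> real"
  assumes [measurable]: "Z \<in> borel_measurable M"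
    and law: "distr M borel Z = distr M borel X" and le: "ess_m M X F U \<beta> \<le> ereal c"
  shows "AE \<omega> in M. F (Z \<omega>) - \<beta> * U (Z \<omega>) \<le> c"
proof -
  have "AE x in distr M borel Z. ereal (F x - \<beta> * U x) \<le> ess_m M X F U \<beta>"
    unfolding law ess_m_def by (rule esssup_AE)
  then have "AE x in distr M borel Z. F x - \<beta> * U x \<le> c"
    by eventually_elim (use le in \<open>metis ereal_less_eq(3) order_trans\<close>)
  then show ?thesis
    by (rule AE_distrD[rotated]) simp
qed

lemma integrable_mult_of_square_integrable:
  fixes f g :: "'a \<Rightarrow> real"
  assumes [measurable]: "f \<in> borel_measurable M" "g \<in> borel_measurable M"
    and "integrable M (\<lambda>x. (f x)\<^sup>2)" "integrable M (\<lambda>x. (g x)\<^sup>2)"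
  shows "integrable M (\<lambda>x. f x * g x)"
proof (rule Bochner_Integration.integrable_bound)
  show "integrable M (\<lambda>x. (f x)\<^sup>2 + (g x)\<^sup>2)"
    using assms by simp
  have "\<bar>f x * g x\<bar> \<le> (f x)\<^sup>2 + (g x)\<^sup>2" for x
  proof -
    have "2 * (\<bar>f x\<bar> * \<bar>g x\<bar>) \<le> (f x)\<^sup>2 + (g x)\<^sup>2"
      using sum_squares_bound[of "\<bar>f x\<bar>" "\<bar>g x\<bar>"] by simp
    moreover have "0 \<le> \<bar>f x\<bar> * \<bar>g x\<bar>" by simp
    ultimately show ?thesis unfolding abs_mult by linarith
  qed
  then show "AE x in M. norm (f x * g x) \<le> norm ((f x)\<^sup>2 + (g x)\<^sup>2)"
    by simp
qed simp

lemma log_ext_le: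
  assumes "0 \<le> p" "p \<le> exp b"
  shows "log_ext p \<le> ereal b"
proof (cases "p = 0")
  case False
  with assms have "ln p \<le> ln (exp b)" by (subst ln_le_cancel_iff) auto
  with False show ?thesis by (simp add: log_ext_def)
qed (simp add: log_ext_def)

section \<open>The three estimates for S_n and T_n\<close>

theorem theorem3p1:
  fixes M :: "'a measure"
    and X :: "'a \<Rightarrow> real"
    and Xs :: "nat \<Rightarrow> 'a \<Rightarrow> real"
    and F U :: "real \<Rightarrow> real"
  assumes "prob_space M"
    and "iid_vars M (Xs(0 := X)) UNIV"
    and "F \<in> borel_measurable borel"
    and "U \<in> borel_measurable borel"
    and "integrable M (\<lambda>\<omega>. F (X \<omega>))"
    and "integrable M (\<lambda>\<omega>. U (X \<omega>))"
    and "integrable M (\<lambda>\<omega>. (F (X \<omega>))\<^sup>2)"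
    and "integrable M (\<lambda>\<omega>. (U (X \<omega>))\<^sup>2)"
    and "prob_space.expectation M (\<lambda>\<omega>. F (X \<omega>)) = 0"
    and "prob_space.expectation M (\<lambda>\<omega>. U (X \<omega>)) = 0"
    and "prob_space.variance M (\<lambda>\<omega>. F (X \<omega>)) \<le> 1"
    and "prob_space.variance M (\<lambda>\<omega>. U (X \<omega>)) = 1"
    and "\<forall>\<beta>>0. ess_m M X F U \<beta> < \<infinity>"
  shows "\<forall>n\<ge>1.
    (\<forall>\<epsilon>>0. \<forall>u>0. (\<exists>\<beta>>0. ess_m M X F U \<beta> \<le> ereal (\<epsilon> - \<beta> * u)) \<longrightarrow>
       \<P>(\<omega> in M. psum F Xs n \<omega> > real n * \<epsilon> \<and> \<bar>psum U Xs n \<omega>\<bar> < real n * u) = 0) \<and>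
    (\<forall>\<epsilon>>0. \<forall>u>0.
       log_ext (\<P>(\<omega> in M. psum F Xs n \<omega> > real n * \<epsilon> \<and> \<bar>psum U Xs n \<omega>\<bar> < real n * u))
       \<le> - (2 * ereal (real n) *
            (SUP \<alpha>\<in>{0<..<1::real}.
               let m = real_of_ereal (ess_m M X F U (\<alpha> * \<epsilon> / u));
                   \<gamma> = prob_space.expectation M (\<lambda>\<omega>. F (X \<omega>) * U (X \<omega>))
               in ereal ((m * (1 - \<alpha>) /
                          (m\<^sup>2 + 1 + (\<alpha> * \<epsilon> / u)\<^sup>2 - 2 * \<alpha> * \<gamma> * \<epsilon> / u))\<^sup>2)) *
            ereal (\<epsilon>\<^sup>2))) \<and>
    (\<forall>K>0. \<forall>\<epsilon>>0. \<forall>u. 0 < u \<and> u \<le> K * \<epsilon> \<longrightarrow>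
       log_ext (\<P>(\<omega> in M. psum F Xs n \<omega> > real n * \<epsilon> \<and> \<bar>psum U Xs n \<omega>\<bar> < real n * u))
       \<le> (let m = real_of_ereal (ess_m M X F U (1 / (2 * K)))
          in ereal (- (real n / 2) * (m / (m\<^sup>2 + (1 + 1 / (2 * K))\<^sup>2))\<^sup>2 * \<epsilon>\<^sup>2)))"
proof -
  interpret prob_space M by fact
  let ?P = "\<lambda>n \<epsilon> u. \<P>(\<omega> in M. psum F Xs n \<omega> > real n * \<epsilon> \<and> \<bar>psum U Xs n \<omega>\<bar> < real n * u)"
  note [measurable] = assms(3,4)
  \<comment> \<open>Index 0 of the updated family is \<open>X\<close>, which overwrites
    \<open>Xs 0\<close>. Facts about \<open>Xs i\<close> are therefore available for
    \<open>1 \<le> i\<close>, the indices that occur in \<open>psum\<close>.\<close>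
  have indep: "indep_vars (\<lambda>_. borel) (Xs(0 := X)) UNIV"
    and law_all: "\<And>i j. distr M borel ((Xs(0 := X)) i) = distr M borel ((Xs(0 := X)) j)"
    using assms(2) by (auto simp: iid_vars_def)
  have rv: "random_variable borel ((Xs(0 := X)) i)" for i
    using indep by (auto simp: indep_vars_def)
  have [measurable]: "random_variable borel X"
    using rv[of 0] by simp
  have rv_Xs: "random_variable borel (Xs i)" if "1 \<le> i" for i
    using rv[of i] that by simp
  have law: "distr M borel (Xs i) = distr M borel X" if "1 \<le> i" for i
    using law_all[of i 0] that by simp
  have indep_Xs: "indep_vars (\<lambda>_. borel) Xs {1..n}" for n
    using indep_vars_subset[OF indep, of "{1..n}"]
    by (rule indep_vars_cong[THEN iffD1, rotated -1]) auto
  have EF: "expectation (\<lambda>\<omega>. F (X \<omega>)) = 0" and EU: "expectation (\<lambda>\<omega>. U (X \<omega>)) = 0"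
    by fact+
  have EF2: "expectation (\<lambda>\<omega>. (F (X \<omega>))\<^sup>2) \<le> 1" and EU2: "expectation (\<lambda>\<omega>. (U (X \<omega>))\<^sup>2) = 1"
    using assms(11,12) by (simp_all add: EF EU)
  have intFU: "integrable M (\<lambda>\<omega>. F (X \<omega>) * U (X \<omega>))"
    using assms by (intro integrable_mult_of_square_integrable) auto
  define \<gamma> where "\<gamma> = expectation (\<lambda>\<omega>. F (X \<omega>) * U (X \<omega>))"
  let ?m = "\<lambda>\<beta>. real_of_ereal (ess_m M X F U \<beta>)"
  have sq_eq: "(F x - \<beta> * U x)\<^sup>2 = (F x)\<^sup>2 - 2 * \<beta> * (F x * U x) + \<beta>\<^sup>2 * (U x)\<^sup>2" for x \<beta>
    by (simp add: power2_eq_square algebra_simps)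
  have int_sq: "integrable M (\<lambda>\<omega>. (F (X \<omega>) - \<beta> * U (X \<omega>))\<^sup>2)" for \<beta>
    unfolding sq_eq using assms(7,8) intFU by simp
  have E_sq: "expectation (\<lambda>\<omega>. (F (X \<omega>) - \<beta> * U (X \<omega>))\<^sup>2) \<le> 1 + \<beta>\<^sup>2 - 2 * \<beta> * \<gamma>" for \<beta>
    unfolding sq_eq using assms(7,8) intFU EF2 EU2 by (simp add: \<gamma>_def)
  \<comment> \<open>At \<open>\<beta> = - 1\<close> the second moment bound reads
    \<open>0 \<le> 2 + 2 * \<gamma>\<close>, a substitute for the Cauchy-Schwarz inequality.\<close>
  have "0 \<le> expectation (\<lambda>\<omega>. (F (X \<omega>) - (- 1) * U (X \<omega>))\<^sup>2)"
    by (intro Bochner_Integration.integral_nonneg) simp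
  from order_trans[OF this E_sq] have \<gamma>: "- 1 \<le> \<gamma>" by simp

  \<comment> \<open>Strictness comes from the strict lower bound on S_n. It matters in part (i),
    where the sum is almost surely at most the left-hand side.\<close>
  have event: "n * (\<epsilon> - \<beta> * u) < (\<Sum>i=1..n. F (Xs i \<omega>) - \<beta> * U (Xs i \<omega>))"
    if "0 < \<beta>" "psum F Xs n \<omega> > real n * \<epsilon>" "\<bar>psum U Xs n \<omega>\<bar> < real n * u" for n \<beta> \<epsilon> u \<omega>
  proof -
    have "\<beta> * psum U Xs n \<omega> \<le> \<beta> * (n * u)"
      using that by (intro mult_left_mono) auto
    moreover have "(\<Sum>i=1..n. F (Xs i \<omega>) - \<beta> * U (Xs i \<omega>)) = psum F Xs n \<omega> - \<beta> * psum U Xs n \<omega>"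
      by (simp add: psum_def sum_subtractf sum_distrib_left)
    ultimately show ?thesis
      using that(2) by (simp add: algebra_simps)
  qed

  \<comment> \<open>\<open>t\<close> and \<open>v\<close> are left free so that one bound serves
    twice: with \<open>(1 - \<alpha>) * \<epsilon>\<close> and the exact expression for
    \<open>v\<close> in (ii), with \<open>\<epsilon> / 2\<close> and
    \<open>(1 + \<beta>)\<^sup>2\<close> in (iii).\<close>
  have tail: "?P n \<epsilon> u \<le> exp (- 2 * real n * (?m \<beta> * t / ((?m \<beta>)\<^sup>2 + v))\<^sup>2)"
    if "1 \<le> n" "0 < \<beta>" "0 < t" "t \<le> \<epsilon> - \<beta> * u" "1 + \<beta>\<^sup>2 - 2 * \<beta> * \<gamma> \<le> v" for n \<beta> t \<epsilon> u v
  proof -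
    let ?Y = "\<lambda>i \<omega>. F (Xs i \<omega>) - \<beta> * U (Xs i \<omega>)"
    have transfer: "integrable M (\<lambda>\<omega>. g (Xs i \<omega>)) \<longleftrightarrow> integrable M (\<lambda>\<omega>. g (X \<omega>))"
      "expectation (\<lambda>\<omega>. g (Xs i \<omega>)) = expectation (\<lambda>\<omega>. g (X \<omega>))"
      if "1 \<le> i" and [measurable]: "g \<in> borel_measurable borel" for i and g :: "real \<Rightarrow> real"
      using law[OF that(1)] rv_Xs[OF that(1)]
        integrable_distr_eq[of "Xs i" M borel g] integrable_distr_eq[of X M borel g]
        integral_distr[of "Xs i" M borel g] integral_distr[of X M borel g]
      by simp_all
    \<comment> \<open>The value \<infinity> is excluded by hypothesis. At -\<infinity>,
      \<open>real_of_ereal\<close> returns 0, which is still an upper bound.\<close>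
    have "ess_m M X F U \<beta> \<le> ereal (?m \<beta>)"
      using assms(13) \<open>0 < \<beta>\<close> by (cases "ess_m M X F U \<beta>") auto
    then have le: "AE \<omega> in M. ?Y i \<omega> \<le> ?m \<beta>" if "1 \<le> i" for i
      using that by (intro AE_le_of_ess_m_le[where X = X] rv_Xs law)
    have "?P n \<epsilon> u \<le> prob {\<omega> \<in> space M. real (card {1..n}) * t \<le> (\<Sum>i=1..n. ?Y i \<omega>)}"
    proof (rule finite_measure_mono)
      have "n * t \<le> n * (\<epsilon> - \<beta> * u)"
        using that by (intro mult_left_mono) auto
      then show "{\<omega> \<in> space M. psum F Xs n \<omega> > real n * \<epsilon> \<and> \<bar>psum U Xs n \<omega>\<bar> < real n * u}
          \<subseteq> {\<omega> \<in> space M. real (card {1..n}) * t \<le> (\<Sum>i=1..n. ?Y i \<omega>)}"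
        by (auto dest!: event[OF \<open>0 < \<beta>\<close>])
      have [measurable]: "random_variable borel (?Y i)" if "i \<in> {1..n}" for i
        using rv_Xs[of i] that by simp
      show "{\<omega> \<in> space M. real (card {1..n}) * t \<le> (\<Sum>i=1..n. ?Y i \<omega>)} \<in> events"
        by measurable
    qed
    also have "\<dots> \<le> exp (- 2 * real (card {1..n}) * (?m \<beta> * t / ((?m \<beta>)\<^sup>2 + v))\<^sup>2)"
    proof (rule one_sided_tail_bound)
      show "indep_vars (\<lambda>_. borel) ?Y {1..n}"
        by (rule indep_vars_compose2[OF indep_Xs]) simp
      show "integrable M (?Y i)" "integrable M (\<lambda>\<omega>. (?Y i \<omega>)\<^sup>2)" "expectation (?Y i) = 0"
        "expectation (\<lambda>\<omega>. (?Y i \<omega>)\<^sup>2) \<le> v" if "i \<in> {1..n}" for i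
        using that assms(5,6) int_sq[of \<beta>] E_sq[of \<beta>] \<open>1 + \<beta>\<^sup>2 - 2 * \<beta> * \<gamma> \<le> v\<close>
        by (simp_all add: EF EU transfer[of i "\<lambda>x. F x - \<beta> * U x"]
            transfer[of i "\<lambda>x. (F x - \<beta> * U x)\<^sup>2"])
    qed (use le that in auto)
    finally show ?thesis by simp
  qed

  have part_i: "?P n \<epsilon> u = 0"
    if "0 < \<beta>" "ess_m M X F U \<beta> \<le> ereal (\<epsilon> - \<beta> * u)" for n \<epsilon> u \<beta>
  proof -
    have "AE \<omega> in M. \<forall>i\<in>{1..n}. F (Xs i \<omega>) - \<beta> * U (Xs i \<omega>) \<le> \<epsilon> - \<beta> * u"
      using that by (intro AE_finite_allI AE_le_of_ess_m_le[where X = X] rv_Xs law) auto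
    then have "AE \<omega> in M. \<not> (psum F Xs n \<omega> > real n * \<epsilon> \<and> \<bar>psum U Xs n \<omega>\<bar> < real n * u)"
    proof eventually_elim
      case (elim \<omega>)
      then have "(\<Sum>i=1..n. F (Xs i \<omega>) - \<beta> * U (Xs i \<omega>)) \<le> of_nat (card {1..n}) * (\<epsilon> - \<beta> * u)"
        by (intro sum_bounded_above) auto
      then show ?case
        using event[OF \<open>0 < \<beta>\<close>, of n \<epsilon> \<omega> u] by auto
    qed
    then show ?thesis
      by (rule prob_eq_0_AE)
  qed

  have part_ii: "log_ext (?P n \<epsilon> u) \<le> - (2 * ereal (real n) *
      (SUP \<alpha>\<in>{0<..<1::real}. let m = ?m (\<alpha> * \<epsilon> / u); \<gamma> = \<gamma> in
        ereal ((m * (1 - \<alpha>) / (m\<^sup>2 + 1 + (\<alpha> * \<epsilon> / u)\<^sup>2 - 2 * \<alpha> * \<gamma> * \<epsilon> / u))\<^sup>2)) * ereal (\<epsilon>\<^sup>2))"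
    (is "_ \<le> - (_ * (SUP \<alpha>\<in>_. ?g \<alpha>) * _)")
    if "1 \<le> n" "0 < \<epsilon>" "0 < u" for n \<epsilon> u
  proof (cases "?P n \<epsilon> u = 0")
    case False
    define p where "p = ?P n \<epsilon> u"
    have "0 < p" using False by (simp add: p_def zero_less_measure_iff)
    \<comment> \<open>The tail bound is solved for the squared bracket. The resulting right-hand
      side does not depend on \<open>\<alpha>\<close>, so it also bounds the supremum, and scaling
      back gives \<open>- ln p\<close>. The case of probability 0 is immediate, its logarithm being
      -\<infinity>.\<close>
    have "?g \<alpha> \<le> ereal (- ln p / (2 * n * \<epsilon>\<^sup>2))" if \<alpha>: "\<alpha> \<in> {0::real<..<1}" for \<alpha>
    proof -
      let ?b = "\<alpha> * \<epsilon> / u"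
      let ?r = "?m ?b * (1 - \<alpha>) / ((?m ?b)\<^sup>2 + 1 + ?b\<^sup>2 - 2 * \<alpha> * \<gamma> * \<epsilon> / u)"
      have "p \<le> exp (- 2 * real n * (?m ?b * ((1 - \<alpha>) * \<epsilon>)
          / ((?m ?b)\<^sup>2 + (1 + ?b\<^sup>2 - 2 * \<alpha> * \<gamma> * \<epsilon> / u)))\<^sup>2)"
        unfolding p_def
      proof (rule tail)
        have "?b * u = \<alpha> * \<epsilon>" using \<open>0 < u\<close> by simp
        then show "(1 - \<alpha>) * \<epsilon> \<le> \<epsilon> - ?b * u" by (simp add: left_diff_distrib)
        have "2 * ?b * \<gamma> = 2 * \<alpha> * \<gamma> * \<epsilon> / u" by (simp only: times_divide_eq_left times_divide_eq_right mult_ac)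
        then show "1 + ?b\<^sup>2 - 2 * ?b * \<gamma> \<le> 1 + ?b\<^sup>2 - 2 * \<alpha> * \<gamma> * \<epsilon> / u" by linarith
      qed (use \<alpha> \<open>1 \<le> n\<close> \<open>0 < \<epsilon>\<close> \<open>0 < u\<close> in simp_all)
      also have "?m ?b * ((1 - \<alpha>) * \<epsilon>) / ((?m ?b)\<^sup>2 + (1 + ?b\<^sup>2 - 2 * \<alpha> * \<gamma> * \<epsilon> / u)) = ?r * \<epsilon>"
        by (simp add: add.assoc add_diff_eq)
      finally have "p \<le> exp (- 2 * real n * (?r * \<epsilon>)\<^sup>2)" .
      with \<open>0 < p\<close> have "ln p \<le> ln (exp (- 2 * real n * (?r * \<epsilon>)\<^sup>2))"
        by (intro ln_mono) auto
      then have "ln p \<le> - 2 * real n * (?r * \<epsilon>)\<^sup>2"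
        by simp
      then have "?r\<^sup>2 * (2 * n * \<epsilon>\<^sup>2) \<le> - ln p"
        unfolding power_mult_distrib by (simp add: mult_ac)
      then have "?r\<^sup>2 \<le> - ln p / (2 * n * \<epsilon>\<^sup>2)"
        using \<open>1 \<le> n\<close> \<open>0 < \<epsilon>\<close> by (subst pos_le_divide_eq) auto
      then show ?thesis by (simp add: Let_def)
    qed
    then have "(SUP \<alpha>\<in>{0<..<1}. ?g \<alpha>) \<le> ereal (- ln p / (2 * n * \<epsilon>\<^sup>2))"
      by (intro SUP_least)
    then have "2 * ereal (real n) * (SUP \<alpha>\<in>{0<..<1}. ?g \<alpha>) * ereal (\<epsilon>\<^sup>2)
        \<le> 2 * ereal (real n) * ereal (- ln p / (2 * n * \<epsilon>\<^sup>2)) * ereal (\<epsilon>\<^sup>2)"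
      by (intro ereal_mult_right_mono ereal_mult_left_mono) auto
    also have "\<dots> = ereal (2 * real n * (- ln p / (2 * n * \<epsilon>\<^sup>2)) * \<epsilon>\<^sup>2)"
      by simp
    also have "2 * real n * (- ln p / (2 * n * \<epsilon>\<^sup>2)) * \<epsilon>\<^sup>2 = - ln p"
      using \<open>1 \<le> n\<close> \<open>0 < \<epsilon>\<close> by simp
    finally have "- ereal (- ln p) \<le> - (2 * ereal (real n) * (SUP \<alpha>\<in>{0<..<1}. ?g \<alpha>) * ereal (\<epsilon>\<^sup>2))"
      by (subst ereal_minus_le_minus)
    with \<open>0 < p\<close> show ?thesis
      by (simp add: log_ext_def p_def)
  qed (simp add: log_ext_def)

  have part_iii: "log_ext (?P n \<epsilon> u) \<le> (let m = ?m (1 / (2 * K))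
      in ereal (- (real n / 2) * (m / (m\<^sup>2 + (1 + 1 / (2 * K))\<^sup>2))\<^sup>2 * \<epsilon>\<^sup>2))"
    if "1 \<le> n" "0 < K" "0 < \<epsilon>" "0 < u" "u \<le> K * \<epsilon>" for n K \<epsilon> u
  proof -
    let ?b = "1 / (2 * K)"
    have "\<epsilon> / 2 \<le> \<epsilon> - ?b * u"
      using that by (simp add: field_simps)
    moreover have "- (2 * ?b) * \<gamma> \<le> 2 * ?b"
      using mult_left_mono[OF \<gamma>, of "2 * ?b"] \<open>0 < K\<close> by simp
    then have "1 + ?b\<^sup>2 - 2 * ?b * \<gamma> \<le> (1 + ?b)\<^sup>2"
      by (simp add: power2_sum)
    ultimately have "?P n \<epsilon> u \<le> exp (- 2 * real n * (?m ?b * (\<epsilon> / 2) / ((?m ?b)\<^sup>2 + (1 + ?b)\<^sup>2))\<^sup>2)"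
      using that by (intro tail) auto
    \<comment> \<open>The factor 1/2 in \<open>t\<close> is squared, which turns the constant 2 of
      the tail bound into 1/2.\<close>
    also have "- 2 * r * (x * (\<epsilon> / 2) / d)\<^sup>2 = - (r / 2) * (x / d)\<^sup>2 * \<epsilon>\<^sup>2" for r x d :: real
      by (simp add: power_mult_distrib power_divide)
    finally show ?thesis
      unfolding Let_def by (intro log_ext_le) auto
  qed

  show ?thesis
  proof (intro allI impI conjI)
    fix n :: nat and \<epsilon> u :: real
    assume "1 \<le> n" "0 < \<epsilon>" "0 < u"
    then show "log_ext (?P n \<epsilon> u) \<le> - (2 * ereal (real n) *
        (SUP \<alpha>\<in>{0<..<1::real}. let m = ?m (\<alpha> * \<epsilon> / u);
          \<gamma> = expectation (\<lambda>\<omega>. F (X \<omega>) * U (X \<omega>)) in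
          ereal ((m * (1 - \<alpha>) / (m\<^sup>2 + 1 + (\<alpha> * \<epsilon> / u)\<^sup>2 - 2 * \<alpha> * \<gamma> * \<epsilon> / u))\<^sup>2)) * ereal (\<epsilon>\<^sup>2))"
      unfolding \<gamma>_def[symmetric] by (rule part_ii)
  next
    fix n :: nat and \<epsilon> u :: real
    assume "\<exists>\<beta>>0. ess_m M X F U \<beta> \<le> ereal (\<epsilon> - \<beta> * u)"
    then show "?P n \<epsilon> u = 0"
      using part_i by blast
  next
    fix n :: nat and K \<epsilon> u :: real
    assume "1 \<le> n" "0 < K" "0 < \<epsilon>" "0 < u \<and> u \<le> K * \<epsilon>"
    then show "log_ext (?P n \<epsilon> u) \<le> (let m = ?m (1 / (2 * K))
        in ereal (- (real n / 2) * (m / (m\<^sup>2 + (1 + 1 / (2 * K))\<^sup>2))\<^sup>2 * \<epsilon>\<^sup>2))"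
      by (intro part_iii) simp_all
  qed
qed

end
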